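(* Any finite-valued nondeterministic finite transducer (NFT) that has an equivalent two-tape deterministic finite automaton (2DFA) has bounded trailing.
   Context: A two-tape deterministic finite automaton (2DFA) is a tuple $A=(Q,\Sigma,\Gamma,\sqcup,\delta,q_0,F)$ with finite nonempty state set $Q$, input alphabet $\Sigma$, output alphabet $\Gamma$, a blank (end-delimiter) symbol $\sqcup\notin\Sigma\cup\Gamma$, initial state $q_0$, accepting states $F$, and transition function $\delta\colon Q\times(\Sigma\cup\{\sqcup\})\times(\Gamma\cup\{\sqcup\})\to Q\times\{\mathrm{Stay},\mathrm{Advance}\}^2$ such that a head reading $\sqcup$ stays and at least one head advances per step. It reads $a\in\Sigma^*$ on the input tape and $u\in\Gamma^*$ on the output tape with one-way heads; $(a,u)\in L(A)$ iff it ends in an accepting state once both heads reach the blanks. A nondeterministic finite transducer (NFT) is $T=(Q,\Sigma,\Gamma,\delta,q_0,F)$ with $\delta$ mapping each $(q,\sigma)\in Q\times\Sigma$ to a finite subset of $Q\times\Gamma^*$; $q\xrightarrow{a/u}q'$ means $T$ can go from $q$ to $q'$ reading $a$ and producing $u$, and $L(T)=\{(a,u)\mid q_0\xrightarrow{a/u}f,\ f\in F\}$. $T$ is finite-valued if there is $k$ such that every input $a$ is related by $L(T)$ to at most $k$ outputs. $T$ is equivalent to $A$ if $L(T)=L(A)$. $T$ has bounded trailing if there is $t\in\mathbb{N}$ such that for all $q_1,q_2\in Q$, $f_1,f_2\in F$, $a,b_1,b_2\in\Sigma^*$, $u,v,w_1,w_2\in\Gamma^*$: if $q_0\xrightarrow{a/uv}q_1\xrightarrow{b_1/w_1}f_1$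 and $q_0\xrightarrow{a/u}q_2\xrightarrow{b_2/vw_2}f_2$, then $|v|\le t$. *)

theory Defs
  imports Main
begin

section \<open>Two-tape deterministic finite automata\<close>

datatype move = Stay | Advance

text \<open>
  The blank is \<open>None\<close>, so it lies outside both alphabets by construction; a letter \<open>x\<close> is
  read as \<open>Some x\<close>.
\<close>

record ('q, 's, 'g) dfa2 =
  dfa2_states :: "'q set"
  dfa2_input :: "'s set"
  dfa2_output :: "'g set"
  dfa2_trans :: "'q \<Rightarrow> 's option \<Rightarrow> 'g option \<Rightarrow> 'q \<times> move \<times> move"
  dfa2_init :: "'q"
  dfa2_final :: "'q set"

text \<open>
  A head on the blank never advances, so when both heads read the blank no head can advance.
  The progress condition is therefore imposed on all other pairs of symbols.
\<close>

definition wf_dfa2 :: "('q, 's, 'g) dfa2 \<Rightarrow> bool" where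
  "wf_dfa2 A \<longleftrightarrow>
     finite (dfa2_states A) \<and> finite (dfa2_input A) \<and> finite (dfa2_output A) \<and>
     dfa2_init A \<in> dfa2_states A \<and> dfa2_final A \<subseteq> dfa2_states A \<and>
     (\<forall>q \<in> dfa2_states A.
      \<forall>x \<in> insert None (Some ` dfa2_input A).
      \<forall>y \<in> insert None (Some ` dfa2_output A).
      \<forall>q' d e. dfa2_trans A q x y = (q', d, e) \<longrightarrow>
        q' \<in> dfa2_states A \<and>
        (x = None \<longrightarrow> d = Stay) \<and> (y = None \<longrightarrow> e = Stay) \<and>
        ((x, y) \<noteq> (None, None) \<longrightarrow> d = Advance \<or> e = Advance))"

fun scan :: "'a list \<Rightarrow> 'a option" where
  "scan [] = None"
| "scan (x # xs) = Some x"

fun shift :: "move \<Rightarrow> 'a list \<Rightarrow> 'a list" where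
  "shift Stay xs = xs"
| "shift Advance xs = tl xs"

text \<open>
  A configuration consists of the state and the unread parts of the two tapes. The automaton halts
  as soon as both heads read the blank.
\<close>

inductive dfa2_step ::
    "('q, 's, 'g) dfa2 \<Rightarrow> 'q \<times> 's list \<times> 'g list \<Rightarrow> 'q \<times> 's list \<times> 'g list \<Rightarrow> bool"
  for A where
  "(a, u) \<noteq> ([], []) \<Longrightarrow> dfa2_trans A q (scan a) (scan u) = (q', d, e) \<Longrightarrow>
   dfa2_step A (q, a, u) (q', shift d a, shift e u)"

definition dfa2_lang :: "('q, 's, 'g) dfa2 \<Rightarrow> ('s list \<times> 'g list) set" where
  "dfa2_lang A = {(a, u). a \<in> lists (dfa2_input A) \<and> u \<in> lists (dfa2_output A) \<and>
     (\<exists>f \<in> dfa2_final A. (dfa2_step A)\<^sup>*\<^sup>* (dfa2_init A, a, u) (f, [], []))}"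

section \<open>Nondeterministic finite transducers\<close>

record ('q, 's, 'g) nft =
  nft_states :: "'q set"
  nft_input :: "'s set"
  nft_output :: "'g set"
  nft_trans :: "'q \<Rightarrow> 's \<Rightarrow> ('q \<times> 'g list) set"
  nft_init :: "'q"
  nft_final :: "'q set"

definition wf_nft :: "('q, 's, 'g) nft \<Rightarrow> bool" where
  "wf_nft T \<longleftrightarrow>
     finite (nft_states T) \<and> finite (nft_input T) \<and> finite (nft_output T) \<and>
     nft_init T \<in> nft_states T \<and> nft_final T \<subseteq> nft_states T \<and>
     (\<forall>q \<in> nft_states T. \<forall>s \<in> nft_input T.
        finite (nft_trans T q s) \<and>
        nft_trans T q s \<subseteq> nft_states T \<times> lists (nft_output T))"

inductive nft_run :: "('q, 's, 'g) nft \<Rightarrow> 'q \<Rightarrow> 's list \<Rightarrow> 'g list \<Rightarrow> 'q \<Rightarrow> bool"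
  for T where
  nft_run_Nil: "q \<in> nft_states T \<Longrightarrow> nft_run T q [] [] q"
| nft_run_Cons: "q \<in> nft_states T \<Longrightarrow> s \<in> nft_input T \<Longrightarrow> (q', u) \<in> nft_trans T q s \<Longrightarrow>
    nft_run T q' a v q'' \<Longrightarrow> nft_run T q (s # a) (u @ v) q''"

definition nft_lang :: "('q, 's, 'g) nft \<Rightarrow> ('s list \<times> 'g list) set" where
  "nft_lang T = {(a, u). \<exists>f \<in> nft_final T. nft_run T (nft_init T) a u f}"

definition finite_valued :: "('q, 's, 'g) nft \<Rightarrow> bool" where
  "finite_valued T \<longleftrightarrow>
     (\<exists>k::nat. \<forall>a \<in> lists (nft_input T).
        finite {u. (a, u) \<in> nft_lang T} \<and> card {u. (a, u) \<in> nft_lang T} \<le> k)"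

definition equivalent :: "('q, 's, 'g) nft \<Rightarrow> ('p, 's, 'g) dfa2 \<Rightarrow> bool" where
  "equivalent T A \<longleftrightarrow> nft_lang T = dfa2_lang A"

definition bounded_trailing :: "('q, 's, 'g) nft \<Rightarrow> bool" where
  "bounded_trailing T \<longleftrightarrow>
     (\<exists>t::nat.
      \<forall>q1 \<in> nft_states T. \<forall>q2 \<in> nft_states T.
      \<forall>f1 \<in> nft_final T. \<forall>f2 \<in> nft_final T.
      \<forall>a \<in> lists (nft_input T). \<forall>b1 \<in> lists (nft_input T). \<forall>b2 \<in> lists (nft_input T).
      \<forall>u \<in> lists (nft_output T). \<forall>v \<in> lists (nft_output T).
      \<forall>w1 \<in> lists (nft_output T). \<forall>w2 \<in> lists (nft_output T).
        nft_run T (nft_init T) a (u @ v) q1 \<and> nft_run T q1 b1 w1 f1 \<and>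
        nft_run T (nft_init T) a u q2 \<and> nft_run T q2 b2 (v @ w2) f2 \<longrightarrow>
        length v \<le> t)"

end

theory Submission imports Defs "HOL-Library.Sublist" begin

text \<open>
  Let \<open>L\<close> be the common relation of the transducer and the automaton. For each input \<open>a\<close> the
  quotient of \<open>L\<close> by \<open>a\<close> is a union of shifted relations \<open>x \<cdot> R\<^sub>i\<close>, where \<open>i\<close> ranges over a finite
  index set: for the transducer, \<open>x\<close> is an output produced on \<open>a\<close> and \<open>i\<close> the state reached; for the
  automaton, \<open>x\<close> is the part of the output tape consumed when \<open>a\<close> has just been read and \<open>i\<close> is the
  state together with the scanned output symbol. As \<open>L\<close> is finite-valued, boundedly many shifts occur
  for each \<open>a\<close>, so around any given shift there is a cluster of bounded radius surrounded by a wide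
  gap. Across the gap nothing can be exchanged, so the two decompositions agree cluster by cluster;
  hence, on an accepted pair, the automaton has consumed nearly the output that a given transducer run
  has produced. Two runs with long trailing would force the automaton to be near \<open>u\<close> and near \<open>uv\<close>
  at the end of \<open>a\<close>, although it cannot distinguish the two output tapes before the end of \<open>uv\<close>.
\<close>

section \<open>Decompositions of finite-valued relations\<close>

text \<open>The abstract index \<open>i\<close> covers both transducer states and pairs of automaton
  state and scanned symbol. Nonemptiness of \<open>R i\<close> makes each point extend to a pair in
  \<open>L\<close>, so valuedness limits the points.\<close>

definition decomposition ::
    "('s list \<times> 'g list) set \<Rightarrow> 'g set \<Rightarrow> 'i set \<Rightarrow> ('s list \<Rightarrow> ('g list \<times> 'i) set) \<Rightarrow>
     ('i \<Rightarrow> ('s list \<times> 'g list) set) \<Rightarrow> bool" where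
  "decomposition L G I X R \<longleftrightarrow> finite I \<and>
     (\<forall>a x i. (x, i) \<in> X a \<longrightarrow> i \<in> I \<and> x \<in> lists G \<and> R i \<noteq> {}) \<and>
     (\<forall>a b z. (a @ b, z) \<in> L \<longleftrightarrow> (\<exists>x i m. (x, i) \<in> X a \<and> z = x @ m \<and> (b, m) \<in> R i))"

definition valued :: "nat \<Rightarrow> ('s list \<times> 'g list) set \<Rightarrow> bool" where
  "valued k L \<longleftrightarrow> (\<forall>a. finite {u. (a, u) \<in> L} \<and> card {u. (a, u) \<in> L} \<le> k)"

text \<open>A ball around \<open>u\<close> whose members share the explicit prefix
  \<open>take (length u - D) u\<close>; clusters cancel this prefix.\<close>

definition near :: "nat \<Rightarrow> 'g list \<Rightarrow> 'g list \<Rightarrow> bool" where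
  "near D u x \<longleftrightarrow> prefix (take (length u - D) u) x \<and> length x \<le> length u + D"

lemma near_refl: "near D u u"
  by (simp add: near_def take_is_prefix)

lemma near_mono:
  assumes "near D u x" "D \<le> D'"
  shows "near D' u x"
proof -
  have "take (length u - D') u = take (length u - D') (take (length u - D) u)"
    using assms(2) by (simp add: min_def)
  then have "prefix (take (length u - D') u) (take (length u - D) u)"
    by (metis take_is_prefix)
  with assms show ?thesis unfolding near_def by (auto intro: prefix_order.trans)
qed

lemma near_length: "near D u x \<Longrightarrow> length u \<le> length x + D \<and> length x \<le> length u + D"
  unfolding near_def by (auto dest!: prefix_length_le)

text \<open>Both \<open>x\<close> and \<open>y\<close> are prefixes of one word, so they are
  comparable, and their lengths differ by at most \<open>B\<close>.\<close>

lemma near_overlap: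
  assumes "near D u x" "x @ m = y @ m'" "length m \<le> B" "length m' \<le> B"
  shows "near (D + B) u y"
proof -
  have len: "length x + length m = length y + length m'"
    using assms(2) by (metis length_append)
  have p: "prefix (take (length u - D) u) (y @ m')"
    using assms(1,2) by (metis near_def prefix_order.trans prefixI)
  have "take (length u - (D + B)) u = take (length u - (D + B)) (take (length u - D) u)"
    by simp
  then have "prefix (take (length u - (D + B)) u) (y @ m')"
    by (metis p prefix_order.trans take_is_prefix)
  moreover have "length (take (length u - (D + B)) u) \<le> length y"
    using near_length[OF assms(1)] len assms(4) by (simp, linarith)
  ultimately have "prefix (take (length u - (D + B)) u) y"
    by (meson prefix_length_prefix prefixI)
  moreover have "length y \<le> length u + (D + B)"
    using assms(1,3) len by (auto simp: near_def)
  ultimately show ?thesis by (simp add: near_def)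
qed

section \<open>Finite valuedness within one decomposition\<close>

lemma decomposition_mem:
  "decomposition L G I X R \<Longrightarrow> (x, i) \<in> X a \<Longrightarrow> (b, m) \<in> R i \<Longrightarrow> (a @ b, x @ m) \<in> L"
  unfolding decomposition_def by blast

lemma decomposition_split:
  assumes "decomposition L G I X R" "(a @ b, z) \<in> L"
  obtains x i m where "(x, i) \<in> X a" "z = x @ m" "(b, m) \<in> R i"
  using assms unfolding decomposition_def by blast

text \<open>Appending one fixed \<open>m\<close> from \<open>R i\<close> to all shifts
  \<open>x\<close> with index \<open>i\<close> gives distinct outputs of a single input, hence at
  most \<open>k\<close> of them per index.\<close>

lemma decomposition_card:
  assumes dec: "decomposition L G I X R" and val: "valued k L"
  shows "finite (fst ` X a)" "card (fst ` X a) \<le> card I * k"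
proof -
  have fin: "finite I" using dec by (simp add: decomposition_def)
  have eq: "fst ` X a = (\<Union>i\<in>I. {x. (x, i) \<in> X a})"
    using dec unfolding decomposition_def by force
  have *: "finite {x. (x, i) \<in> X a} \<and> card {x. (x, i) \<in> X a} \<le> k" for i
  proof (cases "{x. (x, i) \<in> X a} = {}")
    case False
    then obtain b m where bm: "(b, m) \<in> R i"
      using dec unfolding decomposition_def by fast
    have sub: "(\<lambda>x. x @ m) ` {x. (x, i) \<in> X a} \<subseteq> {u. (a @ b, u) \<in> L}"
      using decomposition_mem[OF dec _ bm] by auto
    have inj: "inj_on (\<lambda>x. x @ m) {x. (x, i) \<in> X a}" by (simp add: inj_on_def)
    show ?thesis
      using val sub inj unfolding valued_def
      by (meson card_inj_on_le inj_on_finite le_trans)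
  qed simp
  show "finite (fst ` X a)" unfolding eq using fin * by blast
  have "card (fst ` X a) \<le> (\<Sum>i\<in>I. card {x. (x, i) \<in> X a})"
    unfolding eq by (rule card_UN_le[OF fin])
  also have "\<dots> \<le> card I * k" using sum_bounded_above[of I "\<lambda>i. card {x. (x, i) \<in> X a}" k] * by simp
  finally show "card (fst ` X a) \<le> card I * k" .
qed

lemma uniform_bound:
  fixes P :: "'a \<Rightarrow> nat \<Rightarrow> bool"
  assumes "finite S" "\<And>x. x \<in> S \<Longrightarrow> \<exists>n. P x n" "\<And>x m n. P x m \<Longrightarrow> m \<le> n \<Longrightarrow> P x n"
  shows "\<exists>n. \<forall>x\<in>S. P x n"
  using assms(1,2)
proof (induction S)
  case (insert y S)
  then obtain m n where "\<forall>x\<in>S. P x m" "P y n" by (metis insertCI)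
  then have "\<forall>x\<in>insert y S. P x (max m n)" using assms(3) by (metis insertE max.cobounded1 max.cobounded2)
  then show ?case ..
qed simp

definition residual_bound ::
    "('s list \<Rightarrow> ('g list \<times> 'i) set) \<Rightarrow> ('i \<Rightarrow> ('s list \<times> 'g list) set) \<Rightarrow> 's list \<Rightarrow> nat \<Rightarrow> bool"
  where "residual_bound X R b B \<longleftrightarrow>
    (\<forall>a x i m. (x, i) \<in> X a \<longrightarrow> (b, m) \<in> R i \<longrightarrow> length m \<le> B)"

lemma residual_bound_mono: "residual_bound X R b B \<Longrightarrow> B \<le> B' \<Longrightarrow> residual_bound X R b B'"
  unfolding residual_bound_def by (meson le_trans)

text \<open>\<open>R i\<close> depends on \<open>i\<close> alone, so a single \<open>a\<close>
  reaching \<open>i\<close> bounds its outputs on \<open>b\<close> for all other inputs too;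
  finiteness of \<open>I\<close> then gives a common bound.\<close>

lemma residual_bound_exists:
  assumes dec: "decomposition L G I X R" and val: "valued k L"
  shows "\<exists>B. residual_bound X R b B"
proof -
  have fin: "finite I" using dec by (simp add: decomposition_def)
  let ?P = "\<lambda>i B. \<forall>a x m. (x, i) \<in> X a \<longrightarrow> (b, m) \<in> R i \<longrightarrow> length m \<le> B"
  have "\<exists>B. ?P i B" for i
  proof (cases "\<exists>a x. (x, i) \<in> X a")
    case True
    then obtain a x where ax: "(x, i) \<in> X a" by blast
    have "(\<lambda>m. x @ m) ` {m. (b, m) \<in> R i} \<subseteq> {u. (a @ b, u) \<in> L}"
      using decomposition_mem[OF dec ax] by auto
    then have "finite {m. (b, m) \<in> R i}"
      using val unfolding valued_def by (meson finite_imageD finite_subset inj_on_def same_append_eq)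
    then have "finite (length ` {m. (b, m) \<in> R i})" by simp
    then obtain B where "\<forall>n \<in> length ` {m. (b, m) \<in> R i}. n \<le> B"
      using finite_nat_set_iff_bounded_le by blast
    then show ?thesis by blast
  qed blast
  then obtain B where "\<forall>i\<in>I. ?P i B"
    using uniform_bound[of I ?P, OF fin] le_trans by blast
  then show ?thesis
    using dec unfolding residual_bound_def decomposition_def by blast
qed

section \<open>Two decompositions of one relation, compared across a gap\<close>

lemma transfer_near:
  assumes X: "decomposition L G I X R" and Y: "decomposition L G J Y S"
    and bounds: "residual_bound X R b B" "residual_bound Y S b B"
    and gap: "\<And>y. y \<in> fst ` Y a \<Longrightarrow> near (D + B) u y \<Longrightarrow> near D u y"
    and x: "(x, i) \<in> X a" "near D u x" "(b, m) \<in> R i"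
  obtains y j m' where "(y, j) \<in> Y a" "near D u y" "x @ m = y @ m'" "(b, m') \<in> S j"
proof -
  obtain y j m' where y: "(y, j) \<in> Y a" "x @ m = y @ m'" "(b, m') \<in> S j"
    using decomposition_split[OF Y decomposition_mem[OF X x(1,3)]] .
  \<comment> \<open>Short residuals move the split point by at most \<open>B\<close>; the gap then
    brings it back within \<open>D\<close>.\<close>
  have "near (D + B) u y"
    using near_overlap[OF x(2) y(2)] bounds x y unfolding residual_bound_def by blast
  then show thesis using that gap y by force
qed

text \<open>With the common prefix stripped, clusters of a fixed radius range over a finite
  collection that depends on neither \<open>a\<close> nor \<open>u\<close>.\<close>

definition cluster :: "nat \<Rightarrow> 'g list \<Rightarrow> ('g list \<times> 'i) set \<Rightarrow> ('g list \<times> 'i) set" where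
  "cluster D u W = {(r, i). (take (length u - D) u @ r, i) \<in> W \<and>
     length (take (length u - D) u @ r) \<le> length u + D}"

definition outputs ::
    "('i \<Rightarrow> ('s list \<times> 'g list) set) \<Rightarrow> ('g list \<times> 'i) set \<Rightarrow> 's list \<Rightarrow> 'g list set" where
  "outputs R U b = {r @ m | r i m. (r, i) \<in> U \<and> (b, m) \<in> R i}"

lemma clusterD:
  "(r, i) \<in> cluster D u W \<Longrightarrow>
    (take (length u - D) u @ r, i) \<in> W \<and> near D u (take (length u - D) u @ r)"
  by (auto simp: cluster_def near_def)

lemma clusterE:
  assumes "(x, i) \<in> W" "near D u x"
  obtains r where "x = take (length u - D) u @ r" "(r, i) \<in> cluster D u W"
  using assms unfolding cluster_def near_def by (auto elim!: prefixE)

lemma cluster_subset: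
  assumes "decomposition L G I X R"
  shows "cluster D u (X a) \<subseteq> {r. set r \<subseteq> G \<and> length r \<le> 2 * D} \<times> I"
  using assms unfolding cluster_def decomposition_def
  by (fastforce simp: min_def split: if_splits)

lemma outputs_subset_of_gap:
  assumes X: "decomposition L G I X R" and Y: "decomposition L G J Y S"
    and bounds: "residual_bound X R b B" "residual_bound Y S b B"
    and gap: "\<And>y. y \<in> fst ` Y a \<Longrightarrow> near (D + B) u y \<Longrightarrow> near D u y"
  shows "outputs R (cluster D u (X a)) b \<subseteq> outputs S (cluster D u (Y a)) b"
proof
  fix z assume "z \<in> outputs R (cluster D u (X a)) b"
  then obtain r i m where z: "z = r @ m" "(r, i) \<in> cluster D u (X a)" "(b, m) \<in> R i"
    by (auto simp: outputs_def)
  let ?p = "take (length u - D) u"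
  note x = clusterD[OF z(2)]
  obtain y j m' where y: "(y, j) \<in> Y a" "near D u y" "(?p @ r) @ m = y @ m'" "(b, m') \<in> S j"
    using transfer_near[OF X Y bounds gap _ _ z(3)] x by metis
  from y(1,2) obtain r' where r': "y = ?p @ r'" "(r', j) \<in> cluster D u (Y a)"
    by (rule clusterE)
  then have "z = r' @ m'" using y(3) z(1) by simp
  then show "z \<in> outputs S (cluster D u (Y a)) b"
    using r' y(4) by (auto simp: outputs_def)
qed

text \<open>
  For a fixed radius only finitely many pairs of clusters occur. Each pair with different outputs
  differs on some input, and the outputs of these finitely many inputs have bounded length; so a
  sufficiently wide gap around the two clusters makes their outputs agree on \<^emph>\<open>every\<close> input.
\<close>

lemma gap_width:
  fixes X :: "'s list \<Rightarrow> ('g list \<times> 'i) set" and Y :: "'s list \<Rightarrow> ('g list \<times> 'j) set"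
  assumes X: "decomposition L G I X R" and Y: "decomposition L G J Y S"
    and val: "valued k L" and G: "finite G"
  shows "\<exists>B. \<forall>a u. (\<forall>w \<in> fst ` X a \<union> fst ` Y a. near (D + B) u w \<longrightarrow> near D u w) \<longrightarrow>
    outputs R (cluster D u (X a)) = outputs S (cluster D u (Y a))"
proof -
  let ?W = "{r. set r \<subseteq> G \<and> length r \<le> 2 * D}"
  define E where "E = {(U, V). U \<subseteq> ?W \<times> I \<and> V \<subseteq> ?W \<times> J \<and> outputs R U \<noteq> outputs S V}"
  have "finite ?W" using G by (rule finite_lists_length_le)
  moreover have "finite I" "finite J" using X Y by (auto simp: decomposition_def)
  ultimately have "finite (Pow (?W \<times> I) \<times> Pow (?W \<times> J))" by simp
  then have finE: "finite E" by (rule finite_subset[rotated]) (auto simp: E_def)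
  \<comment> \<open>A separating test input \<open>b\<close> together with a bound on its residuals;
    enlarging \<open>B\<close> keeps the same \<open>b\<close>, as \<open>uniform_bound\<close>
    requires.\<close>
  let ?P = "\<lambda>(U, V) B. \<exists>b. outputs R U b \<noteq> outputs S V b \<and> residual_bound X R b B \<and> residual_bound Y S b B"
  have ex: "\<exists>B. ?P UV B" if "UV \<in> E" for UV
  proof -
    obtain U V where UV: "UV = (U, V)" by (cases UV)
    with that obtain b where b: "outputs R U b \<noteq> outputs S V b" by (auto simp: E_def fun_eq_iff)
    obtain B1 B2 where "residual_bound X R b B1" "residual_bound Y S b B2"
      using residual_bound_exists X Y val by metis
    then have "residual_bound X R b (max B1 B2)" "residual_bound Y S b (max B1 B2)"
      by (auto elim: residual_bound_mono)
    with b UV show ?thesis by auto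
  qed
  have mono: "?P UV B'" if "?P UV B" "B \<le> B'" for UV B B'
    using that by (auto split: prod.splits intro: residual_bound_mono)
  have "\<exists>B. \<forall>UV\<in>E. ?P UV B"
    by (rule uniform_bound[OF finE ex]) (assumption | rule mono)+
  then obtain B where B: "\<forall>UV\<in>E. ?P UV B" ..
  show ?thesis
  proof (intro exI[of _ B] allI impI)
    fix a u
    assume gap: "\<forall>w \<in> fst ` X a \<union> fst ` Y a. near (D + B) u w \<longrightarrow> near D u w"
    show "outputs R (cluster D u (X a)) = outputs S (cluster D u (Y a))"
    proof (rule ccontr)
      assume "\<not> ?thesis"
      then have "(cluster D u (X a), cluster D u (Y a)) \<in> E"
        using cluster_subset[OF X] cluster_subset[OF Y] by (simp add: E_def)
      with B obtain b where b: "outputs R (cluster D u (X a)) b \<noteq> outputs S (cluster D u (Y a)) b"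
          "residual_bound X R b B" "residual_bound Y S b B" by fastforce
      have "outputs R (cluster D u (X a)) b \<subseteq> outputs S (cluster D u (Y a)) b"
        by (rule outputs_subset_of_gap[OF X Y b(2,3)]) (use gap in blast)
      moreover have "outputs S (cluster D u (Y a)) b \<subseteq> outputs R (cluster D u (X a)) b"
        by (rule outputs_subset_of_gap[OF Y X b(3,2)]) (use gap in blast)
      ultimately show False using b(1) by blast
    qed
  qed
qed

text \<open>Pigeonhole: the \<open>N + 1\<close> annuli between consecutive radii are disjoint, so
  \<open>N\<close> words cannot meet all of them.\<close>

lemma empty_annulus:
  fixes D :: "nat \<Rightarrow> nat"
  assumes "mono D" "finite W" "card W \<le> N"
  obtains n where "n \<le> N" "\<And>w. w \<in> W \<Longrightarrow> near (D (Suc n)) u w \<Longrightarrow> near (D n) u w"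
proof (rule ccontr)
  assume "\<not> thesis"
  with that have "\<forall>n\<le>N. \<exists>w\<in>W. near (D (Suc n)) u w \<and> \<not> near (D n) u w" by blast
  then obtain p where p: "\<And>n. n \<le> N \<Longrightarrow> p n \<in> W \<and> near (D (Suc n)) u (p n) \<and> \<not> near (D n) u (p n)"
    by metis
  have neq: "p m \<noteq> p n" if "m < n" "n \<le> N" for m n
  proof
    assume "p m = p n"
    moreover have "near (D n) u (p m)"
      using p[of m] that near_mono monoD[OF assms(1), of "Suc m" n] by fastforce
    ultimately show False using p[of n] that by simp
  qed
  have "inj_on p {..N}"
    unfolding inj_on_def using neq by (metis atMost_iff linorder_neqE_nat)
  moreover have "p ` {..N} \<subseteq> W" using p by auto
  ultimately have "card {..N} \<le> card W" using assms(2) card_inj_on_le by blast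
  then show False using assms(3) by simp
qed

text \<open>
  The bound is uniform in the continuation \<open>b\<close>, although the radii of the clusters were obtained
  from finitely many test inputs only.
\<close>

lemma decompositions_close:
  assumes X: "decomposition L G I X R" and Y: "decomposition L G J Y S"
    and val: "valued k L" and G: "finite G"
  shows "\<exists>D. \<forall>a x i b m. (x, i) \<in> X a \<longrightarrow> (b, m) \<in> R i \<longrightarrow>
    (\<exists>y j m'. (y, j) \<in> Y a \<and> (b, m') \<in> S j \<and> x @ m = y @ m' \<and> near D x y)"
proof -
  obtain B where B: "\<And>D a u. (\<forall>w \<in> fst ` X a \<union> fst ` Y a. near (D + B D) u w \<longrightarrow> near D u w) \<Longrightarrow>
    outputs R (cluster D u (X a)) = outputs S (cluster D u (Y a))"
    using gap_width[OF X Y val G] by metis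
  \<comment> \<open>Each radius exceeds the previous one by exactly the gap width that makes the
    clusters at the previous radius agree.\<close>
  define D where "D n = ((\<lambda>d. d + B d) ^^ n) 0" for n
  have D_Suc: "D (Suc n) = D n + B (D n)" for n by (simp add: D_def)
  have monoD: "mono D" by (rule mono_iff_le_Suc[THEN iffD2]) (simp add: D_Suc)
  \<comment> \<open>Bounds the number of shifts of both decompositions for every \<open>a\<close>,
    so the radius \<open>D N\<close> is uniform.\<close>
  define N where "N = card I * k + card J * k"
  show ?thesis
  proof (intro exI[of _ "D N"] allI impI)
    fix a x i b m
    assume x: "(x, i) \<in> X a" "(b, m) \<in> R i"
    let ?W = "fst ` X a \<union> fst ` Y a"
    have "finite ?W" using decomposition_card[OF X val] decomposition_card[OF Y val] by blast
    moreover have "card ?W \<le> N"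
      unfolding N_def using decomposition_card(2)[OF X val] decomposition_card(2)[OF Y val]
      by (meson add_mono card_Un_le le_trans)
    ultimately obtain n where n: "n \<le> N" "\<And>w. w \<in> ?W \<Longrightarrow> near (D (Suc n)) x w \<Longrightarrow> near (D n) x w"
      using empty_annulus[OF monoD] by metis
    then have eq: "outputs R (cluster (D n) x (X a)) = outputs S (cluster (D n) x (Y a))"
      using B[of a "D n" x] by (simp add: D_Suc)
    let ?p = "take (length x - D n) x"
    \<comment> \<open>The cluster is centred at \<open>x\<close> itself, hence contains it; equal
      outputs then give a nearby point of \<open>Y\<close> producing the same word on
      \<open>b\<close>.\<close>
    obtain r where r: "x = ?p @ r" "(r, i) \<in> cluster (D n) x (X a)"
      using clusterE[OF x(1) near_refl] .
    have "r @ m \<in> outputs S (cluster (D n) x (Y a)) b"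
      unfolding eq[symmetric] using r(2) x(2) by (auto simp: outputs_def)
    then obtain r' j m' where r': "r @ m = r' @ m'" "(r', j) \<in> cluster (D n) x (Y a)" "(b, m') \<in> S j"
      by (auto simp: outputs_def)
    have "x @ m = (?p @ r') @ m'" using r(1) r'(1) by (metis append.assoc)
    moreover have "(?p @ r', j) \<in> Y a" "near (D N) x (?p @ r')"
      using clusterD[OF r'(2)] near_mono monotoneD[OF monoD n(1)] by auto
    ultimately show "\<exists>y j m'. (y, j) \<in> Y a \<and> (b, m') \<in> S j \<and> x @ m = y @ m' \<and> near (D N) x y"
      using r'(3) by blast
  qed
qed

section \<open>The decomposition given by a transducer\<close>

lemma nft_run_states: "nft_run T q a u q' \<Longrightarrow> q \<in> nft_states T \<and> q' \<in> nft_states T"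
  by (induction rule: nft_run.induct) auto

lemma nft_run_input: "nft_run T q a u q' \<Longrightarrow> a \<in> lists (nft_input T)"
  by (induction rule: nft_run.induct) auto

lemma nft_run_output: "nft_run T q a u q' \<Longrightarrow> wf_nft T \<Longrightarrow> u \<in> lists (nft_output T)"
proof (induction rule: nft_run.induct)
  case (nft_run_Cons q s q' u a v q'')
  then have "u \<in> lists (nft_output T)"
    unfolding wf_nft_def by blast
  then show ?case using nft_run_Cons by simp
qed simp

lemma nft_run_append:
  "nft_run T q a u q' \<Longrightarrow> nft_run T q' b v q'' \<Longrightarrow> nft_run T q (a @ b) (u @ v) q''"
  by (induction rule: nft_run.induct) (auto intro: nft_run.intros)

lemma nft_run_split:
  "nft_run T q (a @ b) z q'' \<Longrightarrow> \<exists>q' u v. z = u @ v \<and> nft_run T q a u q' \<and> nft_run T q' b v q''"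
proof (induction a arbitrary: q z)
  case Nil
  then show ?case using nft_run_states nft_run_Nil by fastforce
next
  case (Cons s a)
  from Cons.prems obtain q1 u v where 1: "q \<in> nft_states T" "s \<in> nft_input T"
      "(q1, u) \<in> nft_trans T q s" "nft_run T q1 (a @ b) v q''" "z = u @ v"
    by (auto elim: nft_run.cases)
  from Cons.IH[OF 1(4)] obtain q' v1 v2 where
      "v = v1 @ v2" "nft_run T q1 a v1 q'" "nft_run T q' b v2 q''" by blast
  with 1 nft_run_Cons[OF 1(1-3)] show ?case by (metis append.assoc)
qed

definition nft_residual :: "('q, 's, 'g) nft \<Rightarrow> 'q \<Rightarrow> ('s list \<times> 'g list) set" where
  "nft_residual T q = {(b, m). \<exists>f\<in>nft_final T. nft_run T q b m f}"

definition nft_points :: "('q, 's, 'g) nft \<Rightarrow> 's list \<Rightarrow> ('g list \<times> 'q) set" where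
  "nft_points T a = {(x, q). nft_run T (nft_init T) a x q \<and> nft_residual T q \<noteq> {}}"

lemma nft_decomposition:
  assumes wf: "wf_nft T" and G: "nft_output T \<subseteq> G"
  shows "decomposition (nft_lang T) G (nft_states T) (nft_points T) (nft_residual T)"
  unfolding decomposition_def
proof (intro conjI allI impI)
  show "finite (nft_states T)" using wf by (simp add: wf_nft_def)
next
  fix a x q assume "(x, q) \<in> nft_points T a"
  then have run: "nft_run T (nft_init T) a x q" and "nft_residual T q \<noteq> {}"
    by (auto simp: nft_points_def)
  then show "q \<in> nft_states T" "nft_residual T q \<noteq> {}" using nft_run_states by metis+
  show "x \<in> lists G" using nft_run_output[OF run wf] lists_mono[OF G] by blast
next
  fix a b z
  show "(a @ b, z) \<in> nft_lang T \<longleftrightarrow>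
    (\<exists>x q m. (x, q) \<in> nft_points T a \<and> z = x @ m \<and> (b, m) \<in> nft_residual T q)"
  proof
    assume "(a @ b, z) \<in> nft_lang T"
    then obtain f where f: "f \<in> nft_final T" "nft_run T (nft_init T) (a @ b) z f"
      by (auto simp: nft_lang_def)
    from nft_run_split[OF f(2)] f(1)
    show "\<exists>x q m. (x, q) \<in> nft_points T a \<and> z = x @ m \<and> (b, m) \<in> nft_residual T q"
      unfolding nft_points_def nft_residual_def by blast
  next
    assume "\<exists>x q m. (x, q) \<in> nft_points T a \<and> z = x @ m \<and> (b, m) \<in> nft_residual T q"
    then show "(a @ b, z) \<in> nft_lang T"
      unfolding nft_points_def nft_residual_def nft_lang_def using nft_run_append by fast
  qed
qed

section \<open>The decomposition given by a two-tape automaton\<close>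

text \<open>
  \<open>arrive A q a z s w\<close>: started in state \<open>q\<close> on an input with prefix \<open>a\<close> and the output \<open>z\<close>, the
  automaton is in state \<open>s\<close> with unread output \<open>w\<close> at the first moment when \<open>a\<close> has been read.
\<close>

inductive arrive ::
    "('q, 's, 'g) dfa2 \<Rightarrow> 'q \<Rightarrow> 's list \<Rightarrow> 'g list \<Rightarrow> 'q \<Rightarrow> 'g list \<Rightarrow> bool"
  for A where
  arrive_Nil: "arrive A q [] w q w"
| arrive_step: "a \<noteq> [] \<Longrightarrow> dfa2_trans A q (scan a) (scan z) = (q', d, e) \<Longrightarrow>
    arrive A q' (shift d a) (shift e z) s w \<Longrightarrow> arrive A q a z s w"

lemma scan_append: "a \<noteq> [] \<Longrightarrow> scan (a @ b) = scan a"
  by (cases a) auto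

lemma shift_append: "a \<noteq> [] \<Longrightarrow> shift d (a @ b) = shift d a @ b"
  by (cases d) auto

lemma arrive_steps: "arrive A q a z s w \<Longrightarrow> (dfa2_step A)\<^sup>*\<^sup>* (q, a @ b, z) (s, b, w)"
proof (induction rule: arrive.induct)
  case (arrive_step a q z q' d e s w)
  then have "dfa2_step A (q, a @ b, z) (q', shift d (a @ b), shift e z)"
    by (intro dfa2_step.intros) (auto simp: scan_append)
  then show ?case using arrive_step by (simp add: shift_append converse_rtranclp_into_rtranclp)
qed simp

text \<open>A step removes at most one input letter, so a halting run passes a configuration with
  exactly \<open>b\<close> unread; the run is cut at the first one.\<close>

lemma steps_arrive:
  assumes "(dfa2_step A)\<^sup>*\<^sup>* (q, a @ b, z) (f, [], [])"
  shows "\<exists>s w. arrive A q a z s w \<and> (dfa2_step A)\<^sup>*\<^sup>* (s, b, w) (f, [], [])"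
proof -
  have "\<forall>q a z. c = (q, a @ b, z) \<longrightarrow>
      (\<exists>s w. arrive A q a z s w \<and> (dfa2_step A)\<^sup>*\<^sup>* (s, b, w) (f, [], []))"
    if "(dfa2_step A)\<^sup>*\<^sup>* c (f, [], [])" for c
    using that
  proof (induction rule: converse_rtranclp_induct)
    case base
    then show ?case by (auto intro: arrive_Nil)
  next
    case (step c c')
    show ?case
    proof (intro allI impI)
      fix q a z assume c: "c = (q, a @ b, z)"
      show "\<exists>s w. arrive A q a z s w \<and> (dfa2_step A)\<^sup>*\<^sup>* (s, b, w) (f, [], [])"
      proof (cases "a = []")
        case True
        then show ?thesis
          using c step(1,2) arrive_Nil by (metis append_Nil converse_rtranclp_into_rtranclp)
      next
        case False
        from step(1) c obtain q' d e where
          t: "dfa2_trans A q (scan a) (scan z) = (q', d, e)" "c' = (q', shift d a @ b, shift e z)"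
          using False by (auto elim!: dfa2_step.cases simp: scan_append shift_append)
        then show ?thesis using step.IH arrive_step[OF False t(1)] by blast
      qed
    qed
  qed
  then show ?thesis using assms by blast
qed

lemma arrive_deterministic:
  "arrive A q a z s w \<Longrightarrow> arrive A q a z s' w' \<Longrightarrow> s = s' \<and> w = w'"
proof (induction rule: arrive.induct)
  case (arrive_Nil q w)
  then show ?case by (auto elim: arrive.cases)
next
  case (arrive_step a q z q' d e s w)
  from arrive_step.prems show ?case
    by (rule arrive.cases) (use arrive_step in auto)
qed

text \<open>The run up to the arrival inspects the unread output only through its first symbol.\<close>

lemma arrive_local:
  "arrive A q a z s w \<Longrightarrow> \<exists>y. z = y @ w \<and> (\<forall>w'. scan w' = scan w \<longrightarrow> arrive A q a (y @ w') s w')"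
proof (induction rule: arrive.induct)
  case (arrive_Nil q w)
  then show ?case by (auto intro: arrive.arrive_Nil)
next
  case (arrive_step a q z q' d e s w)
  from arrive_step.IH obtain y where y: "shift e z = y @ w"
    "\<And>w'. scan w' = scan w \<Longrightarrow> arrive A q' (shift d a) (y @ w') s w'" by blast
  have Nil: "scan v = None \<longleftrightarrow> v = []" for v :: "'c list" by (cases v) auto
  obtain y' where y': "z = y' @ w" "\<And>w'. scan w' = scan w \<Longrightarrow> shift e (y' @ w') = y @ w'"
  \<comment> \<open>If the head stays, or the tape is empty (\<open>tl [] = []\<close>), the
    consumed part is unchanged; otherwise the letter just passed is put in front of it.\<close>
  proof (cases "e = Stay \<or> z = []")
    case True
    show ?thesis
    proof (rule that[of y])
      show "z = y @ w" using True y(1) by (cases e) auto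
      show "shift e (y @ w') = y @ w'" if "scan w' = scan w" for w'
      proof (cases e)
        case Advance
        then have "z = []" "y = []" "w = []" using True y(1) by auto
        then show ?thesis using that Nil[of w'] Advance by simp
      qed simp
    qed
  next
    case False
    then obtain c z' where "z = c # z'" "e = Advance" by (cases e; cases z) auto
    then show ?thesis using that[of "c # y"] y(1) by auto
  qed
  have "arrive A q a (y' @ w') s w'" if w': "scan w' = scan w" for w'
  proof -
    have "scan (y' @ w') = scan z" using w' y'(1) by (cases y') auto
    then show ?thesis
      using arrive.arrive_step[OF arrive_step.hyps(1)] arrive_step.hyps(2) y(2) y'(2) w' by metis
  qed
  with y'(1) show ?case by blast
qed

lemma scan_in: "x \<in> lists S \<Longrightarrow> scan x \<in> insert None (Some ` S)"
  by (cases x) auto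

lemma shift_in: "x \<in> lists S \<Longrightarrow> shift d x \<in> lists S"
  by (cases d; cases x) auto

lemma arrive_states:
  assumes wf: "wf_dfa2 A"
  shows "arrive A q a z s w \<Longrightarrow> q \<in> dfa2_states A \<Longrightarrow> a \<in> lists (dfa2_input A) \<Longrightarrow>
    z \<in> lists (dfa2_output A) \<Longrightarrow> s \<in> dfa2_states A"
proof (induction rule: arrive.induct)
  case (arrive_step a q z q' d e s w)
  have "q' \<in> dfa2_states A"
    using wf arrive_step.hyps(2) arrive_step.prems scan_in[of a "dfa2_input A"] scan_in[of z "dfa2_output A"]
    unfolding wf_dfa2_def by blast
  then show ?case using arrive_step shift_in by metis
qed

text \<open>Recording the scanned symbol \<open>g\<close> in the index makes the arrival independent
  of the rest of the tape, so that shifts and residuals combine freely.\<close>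

definition dfa2_residual ::
    "('q, 's, 'g) dfa2 \<Rightarrow> 'q \<times> 'g option \<Rightarrow> ('s list \<times> 'g list) set" where
  "dfa2_residual A = (\<lambda>(s, g). {(b, w). scan w = g \<and> b \<in> lists (dfa2_input A) \<and>
     w \<in> lists (dfa2_output A) \<and> (\<exists>f\<in>dfa2_final A. (dfa2_step A)\<^sup>*\<^sup>* (s, b, w) (f, [], []))})"

definition dfa2_points ::
    "('q, 's, 'g) dfa2 \<Rightarrow> 's list \<Rightarrow> ('g list \<times> 'q \<times> 'g option) set" where
  "dfa2_points A a = {(y, s, g). a \<in> lists (dfa2_input A) \<and> y \<in> lists (dfa2_output A) \<and>
     (\<forall>w. scan w = g \<longrightarrow> arrive A (dfa2_init A) a (y @ w) s w) \<and> dfa2_residual A (s, g) \<noteq> {}}"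

lemma dfa2_decomposition:
  assumes wf: "wf_dfa2 A" and G: "dfa2_output A \<subseteq> G"
  shows "decomposition (dfa2_lang A) G
    (dfa2_states A \<times> insert None (Some ` dfa2_output A)) (dfa2_points A) (dfa2_residual A)"
  unfolding decomposition_def
proof (intro conjI allI impI)
  show "finite (dfa2_states A \<times> insert None (Some ` dfa2_output A))"
    using wf by (simp add: wf_dfa2_def)
next
  fix a y and i :: "'a \<times> 'c option"
  assume "(y, i) \<in> dfa2_points A a"
  then obtain s g where i: "i = (s, g)" and a: "a \<in> lists (dfa2_input A)"
    and y: "y \<in> lists (dfa2_output A)"
    and arr: "\<And>w. scan w = g \<Longrightarrow> arrive A (dfa2_init A) a (y @ w) s w"
    and res: "dfa2_residual A (s, g) \<noteq> {}"
    by (auto simp: dfa2_points_def)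
  show "dfa2_residual A i \<noteq> {}" using i res by simp
  show "y \<in> lists G" using y lists_mono[OF G] by blast
  \<comment> \<open>A residual word supplies a concrete tape over the output alphabet on which the
    arrival stays within the state set.\<close>
  from res obtain w where w: "scan w = g" "w \<in> lists (dfa2_output A)"
    by (auto simp: dfa2_residual_def)
  have init: "dfa2_init A \<in> dfa2_states A" using wf by (simp add: wf_dfa2_def)
  have "s \<in> dfa2_states A"
    using arrive_states[OF wf arr[OF w(1)] init a] y w(2) by simp
  then show "i \<in> dfa2_states A \<times> insert None (Some ` dfa2_output A)"
    using i w(1) scan_in[OF w(2)] by simp
next
  fix a b z
  show "(a @ b, z) \<in> dfa2_lang A \<longleftrightarrow>
    (\<exists>y i m. (y, i) \<in> dfa2_points A a \<and> z = y @ m \<and> (b, m) \<in> dfa2_residual A i)"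
  proof
    assume "(a @ b, z) \<in> dfa2_lang A"
    then obtain f where f: "a \<in> lists (dfa2_input A)" "b \<in> lists (dfa2_input A)"
        "z \<in> lists (dfa2_output A)" "f \<in> dfa2_final A"
        "(dfa2_step A)\<^sup>*\<^sup>* (dfa2_init A, a @ b, z) (f, [], [])"
      by (auto simp: dfa2_lang_def)
    from steps_arrive[OF f(5)] obtain s w where
      s: "arrive A (dfa2_init A) a z s w" "(dfa2_step A)\<^sup>*\<^sup>* (s, b, w) (f, [], [])" by blast
    from arrive_local[OF s(1)] obtain y where y: "z = y @ w"
      "\<And>w'. scan w' = scan w \<Longrightarrow> arrive A (dfa2_init A) a (y @ w') s w'" by blast
    have res: "(b, w) \<in> dfa2_residual A (s, scan w)"
      using f s(2) y(1) by (auto simp: dfa2_residual_def)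
    then have "(y, s, scan w) \<in> dfa2_points A a"
      using f y by (auto simp: dfa2_points_def)
    with res y(1)
    show "\<exists>y i m. (y, i) \<in> dfa2_points A a \<and> z = y @ m \<and> (b, m) \<in> dfa2_residual A i" by blast
  next
    assume "\<exists>y i m. (y, i) \<in> dfa2_points A a \<and> z = y @ m \<and> (b, m) \<in> dfa2_residual A i"
    then obtain y s g m where p: "(y, s, g) \<in> dfa2_points A a" and z: "z = y @ m"
      and r: "(b, m) \<in> dfa2_residual A (s, g)" by auto
    from r obtain f where f: "scan m = g" "b \<in> lists (dfa2_input A)" "m \<in> lists (dfa2_output A)"
      "f \<in> dfa2_final A" "(dfa2_step A)\<^sup>*\<^sup>* (s, b, m) (f, [], [])"
      by (auto simp: dfa2_residual_def)
    from p f(1) have "arrive A (dfa2_init A) a z s m" and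
      ay: "a \<in> lists (dfa2_input A)" "y \<in> lists (dfa2_output A)"
      using z by (auto simp: dfa2_points_def)
    then have "(dfa2_step A)\<^sup>*\<^sup>* (dfa2_init A, a @ b, z) (f, [], [])"
      using arrive_steps f(5) by (metis rtranclp_trans)
    then show "(a @ b, z) \<in> dfa2_lang A"
      using f ay z by (auto simp: dfa2_lang_def)
  qed
qed

section \<open>Bounded trailing\<close>

lemma arrival_close:
  fixes T :: "('q, 's, 'g) nft" and A :: "('p, 's, 'g) dfa2"
  assumes "wf_nft T" and "finite_valued T" and "wf_dfa2 A" and "equivalent T A"
  shows "\<exists>D. \<forall>a x q b m f. nft_run T (nft_init T) a x q \<longrightarrow> nft_run T q b m f \<longrightarrow>
    f \<in> nft_final T \<longrightarrow> (\<exists>y s w. x @ m = y @ w \<and> near D x y \<and>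
      (\<forall>w'. scan w' = scan w \<longrightarrow> arrive A (dfa2_init A) a (y @ w') s w'))"
proof -
  \<comment> \<open>The two machines may declare different output alphabets, while both
    decompositions must share one.\<close>
  let ?G = "nft_output T \<union> dfa2_output A"
  from assms(2) obtain k where k: "\<forall>a \<in> lists (nft_input T).
      finite {u. (a, u) \<in> nft_lang T} \<and> card {u. (a, u) \<in> nft_lang T} \<le> k"
    by (auto simp: finite_valued_def)
  have val: "valued k (nft_lang T)"
    unfolding valued_def
  proof
    fix a
    show "finite {u. (a, u) \<in> nft_lang T} \<and> card {u. (a, u) \<in> nft_lang T} \<le> k"
    proof (cases "a \<in> lists (nft_input T)")
      case False
      then have "{u. (a, u) \<in> nft_lang T} = {}"
        using nft_run_input by (fastforce simp: nft_lang_def)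
      then show ?thesis by (metis card.empty finite.emptyI zero_le)
    qed (use k in blast)
  qed
  have G: "finite ?G" using assms(1,3) by (simp add: wf_nft_def wf_dfa2_def)
  have X: "decomposition (nft_lang T) ?G (nft_states T) (nft_points T) (nft_residual T)"
    using nft_decomposition[OF assms(1)] by simp
  have Y: "decomposition (nft_lang T) ?G
      (dfa2_states A \<times> insert None (Some ` dfa2_output A)) (dfa2_points A) (dfa2_residual A)"
    using dfa2_decomposition[OF assms(3)] assms(4) by (simp add: equivalent_def)
  obtain D where D: "\<And>a x q b m. (x, q) \<in> nft_points T a \<Longrightarrow> (b, m) \<in> nft_residual T q \<Longrightarrow>
    \<exists>y j w. (y, j) \<in> dfa2_points A a \<and> (b, w) \<in> dfa2_residual A j \<and> x @ m = y @ w \<and> near D x y"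
    using decompositions_close[OF X Y val G] by blast
  show ?thesis
  proof (intro exI[of _ D] allI impI)
    fix a x q b m f
    assume "nft_run T (nft_init T) a x q" "nft_run T q b m f" "f \<in> nft_final T"
    then have "(b, m) \<in> nft_residual T q" "(x, q) \<in> nft_points T a"
      by (auto simp: nft_residual_def nft_points_def)
    with D obtain y s g w where "(y, s, g) \<in> dfa2_points A a" "(b, w) \<in> dfa2_residual A (s, g)"
      "x @ m = y @ w" "near D x y" by (metis surj_pair)
    then show "\<exists>y s w. x @ m = y @ w \<and> near D x y \<and>
      (\<forall>w'. scan w' = scan w \<longrightarrow> arrive A (dfa2_init A) a (y @ w') s w')"
      by (auto simp: dfa2_points_def dfa2_residual_def)
  qed
qed

theorem theorem2:
  fixes T :: "('q, 's, 'g) nft" and A :: "('p, 's, 'g) dfa2"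
  assumes "wf_nft T" and "finite_valued T"
    and "wf_dfa2 A" and "equivalent T A"
  shows "bounded_trailing T"
proof -
  obtain D where D: "\<And>a x q b m f. nft_run T (nft_init T) a x q \<Longrightarrow> nft_run T q b m f \<Longrightarrow>
    f \<in> nft_final T \<Longrightarrow> \<exists>y s w. x @ m = y @ w \<and> near D x y \<and>
      (\<forall>w'. scan w' = scan w \<longrightarrow> arrive A (dfa2_init A) a (y @ w') s w')"
    using arrival_close[OF assms] by blast
  have "length v \<le> 2 * D"
    if f: "f1 \<in> nft_final T" "f2 \<in> nft_final T"
      and r1: "nft_run T (nft_init T) a (u @ v) q1" "nft_run T q1 b1 w1 f1"
      and r2: "nft_run T (nft_init T) a u q2" "nft_run T q2 b2 (v @ w2) f2"
    for a u v q1 q2 b1 b2 w1 w2 f1 f2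
  proof (rule ccontr)
    assume long: "\<not> ?thesis"
    obtain y1 s1 z1 where 1: "(u @ v) @ w1 = y1 @ z1" "near D (u @ v) y1"
        "\<And>w'. scan w' = scan z1 \<Longrightarrow> arrive A (dfa2_init A) a (y1 @ w') s1 w'"
      using D[OF r1 f(1)] by blast
    obtain y2 s2 z2 where 2: "u @ v @ w2 = y2 @ z2" "near D u y2"
        "\<And>w'. scan w' = scan z2 \<Longrightarrow> arrive A (dfa2_init A) a (y2 @ w') s2 w'"
      using D[OF r2 f(2)] by blast
    \<comment> \<open>As \<open>length v\<close> exceeds \<open>2 * D\<close>, the balls around
      \<open>u\<close> and \<open>u @ v\<close> are separated in length, and \<open>y2\<close> ends
      strictly inside \<open>u @ v\<close>.\<close>
    have len: "length y2 < length y1" "length y2 < length (u @ v)"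
      using near_length[OF 1(2)] near_length[OF 2(2)] long by auto
    then obtain v' where v': "u @ v = y2 @ v'" "z2 = v' @ w2"
      using 2(1) by (auto simp: append_eq_append_conv2 simp flip: append_assoc)
    then have "v' \<noteq> []" using len(2) by auto
    \<comment> \<open>The symbol scanned after \<open>y2\<close> lies in \<open>v'\<close>, so the
      second arrival survives replacing \<open>w2\<close> by \<open>w1\<close>. It now competes with
      the first arrival on the same tapes, against determinism.\<close>
    then have "arrive A (dfa2_init A) a (y2 @ v' @ w1) s2 (v' @ w1)"
      using 2(3) v' by (simp add: scan_append)
    moreover have "y2 @ v' @ w1 = y1 @ z1" using 1(1) v'(1) by simp
    ultimately have "z1 = v' @ w1" using 1(3) arrive_deterministic by metis
    then show False using len(1) \<open>y2 @ v' @ w1 = y1 @ z1\<close> by simp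
  qed
  then show ?thesis unfolding bounded_trailing_def by blast
qed

end
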